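(* Let $S=\mathscr{M}[G;I,\Lambda;P]$ be a completely simple semigroup. The principal cones $\rho^a$ ($a\in S$) in $T\mathcal{L}(S)$ form a regular subsemigroup of $G^\Lambda\ltimes\Lambda$, where $T\mathcal{L}(S)$ is identified with $G^\Lambda\ltimes\Lambda$.
   Context: $G$ is a group, $I,\Lambda$ are nonempty sets, $P=(p_{\lambda i})$ is a $\Lambda\times I$ matrix over $G$, and $S=\mathscr{M}[G;I,\Lambda;P]=G\times I\times\Lambda$ with product $(a,i,\lambda)(b,j,\mu)=(ap_{\lambda j}b,i,\mu)$. Category $\mathcal{L}(S)$ (composition written left to right): objects are the principal left ideals $Se$, $e$ idempotent; morphisms $Se\to Sf$ are the right translations $\rho(e,s,f):x\mapsto xs$ with $s\in eSf$. For the present $S$ the objects are $\bar\lambda=G\times I\times\{\lambda\}$, $\lambda\in\Lambda$, and the morphisms $\bar\lambda_1\to\bar\lambda_2$ are the maps $\rho(g):(h,i,\lambda_1)\mapsto(hg,i,\lambda_2)$, $g\in G$. All morphisms are isomorphisms and the only inclusions are identities. A normal cone $\gamma$ in $\mathcal{L}(S)$ with vertex $\bar\lambda$ is a choice of morphisms $\gamma(\bar\mu):\bar\mu\to\bar\lambda$ for all $\mu\in\Lambda$; it is identified with $(\bar\gamma,\lambda)\in G^\Lambda\times\Lambda$ where $\gamma(\bar\mu)=\rho(\bar\gamma(\mu))$. The product of normal cones is $(\gamma_1\ast\gamma_2)(\bar\mu)=\gamma_1(\bar\mu)\gamma_2(c_{\gamma_1})$, $c_{\gamma_1}$ being the vertex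 of $\gamma_1$; in coordinates this is the semidirect product $G^\Lambda\ltimes\Lambda$: $(\bar\gamma_1,\lambda_k)\ast(\bar\gamma_2,\lambda_l)=(\bar\gamma_1\cdot\bar g_k,\lambda_l)$, where $g_k=\bar\gamma_2(\lambda_k)$ and $\bar g_k=(g_k,g_k,\dots)$ is constant. For $a\in S$ and an idempotent $f\,\mathscr{L}\,a$, the principal cone $\rho^a$ is the normal cone with vertex $Sa=Sf$ and components $\rho^a(Se)=\rho(e,ea,f)$ (i.e. $x\mapsto xa$) for each idempotent $e$. *)

theory Defs
  imports "HOL-Algebra.Group"
begin

section \<open>Semigroups with an explicit carrier\<close>

record 'a sgrp = "'a partial_object" +
  smul :: "'a \<Rightarrow> 'a \<Rightarrow> 'a"  (infixl \<open>\<star>\<index>\<close> 70)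

definition is_semigroup :: "'a sgrp \<Rightarrow> bool" where
  "is_semigroup S \<longleftrightarrow>
     (\<forall>x\<in>carrier S. \<forall>y\<in>carrier S. x \<star>\<^bsub>S\<^esub> y \<in> carrier S) \<and>
     (\<forall>x\<in>carrier S. \<forall>y\<in>carrier S. \<forall>z\<in>carrier S.
        (x \<star>\<^bsub>S\<^esub> y) \<star>\<^bsub>S\<^esub> z = x \<star>\<^bsub>S\<^esub> (y \<star>\<^bsub>S\<^esub> z))"

definition sgrp_iso :: "'a sgrp \<Rightarrow> 'b sgrp \<Rightarrow> ('a \<Rightarrow> 'b) set" where
  "sgrp_iso S T = {h. bij_betw h (carrier S) (carrier T) \<and>
     (\<forall>x\<in>carrier S. \<forall>y\<in>carrier S. h (x \<star>\<^bsub>S\<^esub> y) = h x \<star>\<^bsub>T\<^esub> h y)}"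

definition subsemigroup :: "'a set \<Rightarrow> 'a sgrp \<Rightarrow> bool" where
  "subsemigroup H T \<longleftrightarrow> is_semigroup T \<and> H \<subseteq> carrier T \<and> H \<noteq> {} \<and>
     (\<forall>x\<in>H. \<forall>y\<in>H. x \<star>\<^bsub>T\<^esub> y \<in> H)"

text \<open>Regularity is that of \<open>H\<close> as a semigroup: the witness \<open>y\<close> has to lie in \<open>H\<close>.\<close>

definition regular_subsemigroup :: "'a set \<Rightarrow> 'a sgrp \<Rightarrow> bool" where
  "regular_subsemigroup H T \<longleftrightarrow> subsemigroup H T \<and>
     (\<forall>x\<in>H. \<exists>y\<in>H. x \<star>\<^bsub>T\<^esub> y \<star>\<^bsub>T\<^esub> x = x)"

definition idempotents :: "'a sgrp \<Rightarrow> 'a set" where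
  "idempotents S = {e \<in> carrier S. e \<star>\<^bsub>S\<^esub> e = e}"

definition left_mults :: "'a sgrp \<Rightarrow> 'a \<Rightarrow> 'a set" where
  "left_mults S a = (\<lambda>x. x \<star>\<^bsub>S\<^esub> a) ` carrier S"

text \<open>The sets \<open>insert a (left_mults S a)\<close> are the principal left ideals of \<open>S\<close> with an identity
  adjoined.\<close>

definition green_L :: "'a sgrp \<Rightarrow> 'a \<Rightarrow> 'a \<Rightarrow> bool" where
  "green_L S a b \<longleftrightarrow> insert a (left_mults S a) = insert b (left_mults S b)"


section \<open>The category of principal left ideals\<close>

text \<open>A morphism carries its domain and codomain; its underlying map is extensional, i.e.
  \<open>undefined\<close> off the domain, so that equality of morphisms is equality on the domain.
  Composition is written left to right.\<close>

record 'a lmor =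
  ldom :: "'a set"
  lmap :: "'a \<Rightarrow> 'a"
  lcod :: "'a set"

definition lcomp :: "'a lmor \<Rightarrow> 'a lmor \<Rightarrow> 'a lmor"  (infixl \<open>;;\<close> 65) where
  "m ;; n = \<lparr>ldom = ldom m, lmap = compose (ldom m) (lmap n) (lmap m), lcod = lcod n\<rparr>"

definition lincl :: "'a set \<Rightarrow> 'a set \<Rightarrow> 'a lmor" where
  "lincl A B = \<lparr>ldom = A, lmap = (\<lambda>x\<in>A. x), lcod = B\<rparr>"

definition lobjs :: "'a sgrp \<Rightarrow> 'a set set" where
  "lobjs S = left_mults S ` idempotents S"

definition rho :: "'a sgrp \<Rightarrow> 'a \<Rightarrow> 'a \<Rightarrow> 'a \<Rightarrow> 'a lmor" where
  "rho S e s f = \<lparr>ldom = left_mults S e, lmap = (\<lambda>x\<in>left_mults S e. x \<star>\<^bsub>S\<^esub> s),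
                  lcod = left_mults S f\<rparr>"

definition lhom :: "'a sgrp \<Rightarrow> 'a set \<Rightarrow> 'a set \<Rightarrow> 'a lmor set" where
  "lhom S A B = {rho S e s f | e s f.
     e \<in> idempotents S \<and> f \<in> idempotents S \<and> left_mults S e = A \<and> left_mults S f = B \<and>
     s \<in> (\<lambda>x. e \<star>\<^bsub>S\<^esub> x \<star>\<^bsub>S\<^esub> f) ` carrier S}"

definition liso :: "'a sgrp \<Rightarrow> 'a set \<Rightarrow> 'a set \<Rightarrow> 'a lmor set" where
  "liso S A B = {m \<in> lhom S A B. \<exists>n\<in>lhom S B A. m ;; n = lincl A A \<and> n ;; m = lincl B B}"


section \<open>Normal cones\<close>

record 'a lcone =
  vertex :: "'a set"
  component :: "'a set \<Rightarrow> 'a lmor"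

text \<open>The last two conditions (compatibility with inclusions, existence of an isomorphism component)
  belong to the general notion of a normal cone. They hold automatically for a Rees matrix semigroup
  over a group, where all inclusions are identities and all morphisms are isomorphisms.\<close>

definition normal_cone :: "'a sgrp \<Rightarrow> 'a lcone \<Rightarrow> bool" where
  "normal_cone S \<gamma> \<longleftrightarrow>
     vertex \<gamma> \<in> lobjs S \<and>
     component \<gamma> \<in> extensional (lobjs S) \<and>
     (\<forall>A\<in>lobjs S. component \<gamma> A \<in> lhom S A (vertex \<gamma>)) \<and>
     (\<forall>A\<in>lobjs S. \<forall>B\<in>lobjs S. A \<subseteq> B \<longrightarrow> lincl A B ;; component \<gamma> B = component \<gamma> A) \<and>
     (\<exists>A\<in>lobjs S. component \<gamma> A \<in> liso S A (vertex \<gamma>))"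

text \<open>For arbitrary \<open>S\<close> the second factor in the product has to be replaced by its epimorphic
  component; here all morphisms are isomorphisms and it is left as it is.\<close>

definition cone_mult :: "'a sgrp \<Rightarrow> 'a lcone \<Rightarrow> 'a lcone \<Rightarrow> 'a lcone" where
  "cone_mult S \<gamma>1 \<gamma>2 =
     \<lparr>vertex = vertex \<gamma>2,
      component = (\<lambda>A\<in>lobjs S. component \<gamma>1 A ;; component \<gamma>2 (vertex \<gamma>1))\<rparr>"

definition TL :: "'a sgrp \<Rightarrow> 'a lcone sgrp" where
  "TL S = \<lparr>carrier = {\<gamma>. normal_cone S \<gamma>}, smul = cone_mult S\<rparr>"

definition principal_cone :: "'a sgrp \<Rightarrow> 'a \<Rightarrow> 'a lcone" where
  "principal_cone S a =
     \<lparr>vertex = left_mults S a,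
      component = (\<lambda>A\<in>lobjs S. \<lparr>ldom = A, lmap = (\<lambda>x\<in>A. x \<star>\<^bsub>S\<^esub> a), lcod = left_mults S a\<rparr>)\<rparr>"

text \<open>The component of the principal cone at \<open>Se\<close> is the right translation \<open>\<rho>(e, ea, f)\<close>.\<close>

lemma left_mults_green_L:
  assumes S: "is_semigroup S" and a: "a \<in> carrier S"
    and f: "f \<in> idempotents S" and L: "green_L S a f"
  shows "left_mults S a = left_mults S f"
proof -
  have fS: "f \<in> carrier S" and ff: "f \<star>\<^bsub>S\<^esub> f = f"
    using f by (auto simp: idempotents_def)
  have "f \<in> left_mults S f"
    unfolding left_mults_def by (rule image_eqI[of _ _ f]) (use fS ff in auto)
  then have eq: "insert a (left_mults S a) = left_mults S f"
    using L by (auto simp: green_L_def)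
  have assoc: "\<And>x y z. x \<in> carrier S \<Longrightarrow> y \<in> carrier S \<Longrightarrow> z \<in> carrier S \<Longrightarrow>
      (x \<star>\<^bsub>S\<^esub> y) \<star>\<^bsub>S\<^esub> z = x \<star>\<^bsub>S\<^esub> (y \<star>\<^bsub>S\<^esub> z)"
    and closed: "\<And>x y. x \<in> carrier S \<Longrightarrow> y \<in> carrier S \<Longrightarrow> x \<star>\<^bsub>S\<^esub> y \<in> carrier S"
    using S unfolding is_semigroup_def by blast+
  have "a \<in> left_mults S a"
  proof -
    obtain y where y: "y \<in> carrier S" "a = y \<star>\<^bsub>S\<^esub> f"
      using eq by (auto simp: left_mults_def)
    have "f = a \<or> (\<exists>x\<in>carrier S. f = x \<star>\<^bsub>S\<^esub> a)"
      using eq \<open>f \<in> left_mults S f\<close> by (auto simp: left_mults_def)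
    then show ?thesis
    proof
      assume "f = a"
      with \<open>f \<in> left_mults S f\<close> show ?thesis by simp
    next
      assume "\<exists>x\<in>carrier S. f = x \<star>\<^bsub>S\<^esub> a"
      then obtain x where x: "x \<in> carrier S" "f = x \<star>\<^bsub>S\<^esub> a" by blast
      have "a = (y \<star>\<^bsub>S\<^esub> x) \<star>\<^bsub>S\<^esub> a"
        unfolding assoc[OF y(1) x(1) a] x(2)[symmetric] by (rule y(2))
      then show ?thesis
        unfolding left_mults_def by (rule image_eqI) (rule closed[OF y(1) x(1)])
    qed
  qed
  then show ?thesis using eq by auto
qed

lemma principal_cone_component:
  assumes S: "is_semigroup S" and a: "a \<in> carrier S"
    and f: "f \<in> idempotents S" and L: "green_L S a f" and e: "e \<in> idempotents S"
  shows "component (principal_cone S a) (left_mults S e) = rho S e (e \<star>\<^bsub>S\<^esub> a) f"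
    and "vertex (principal_cone S a) = left_mults S f"
proof -
  have assoc: "\<And>x y z. x \<in> carrier S \<Longrightarrow> y \<in> carrier S \<Longrightarrow> z \<in> carrier S \<Longrightarrow>
      (x \<star>\<^bsub>S\<^esub> y) \<star>\<^bsub>S\<^esub> z = x \<star>\<^bsub>S\<^esub> (y \<star>\<^bsub>S\<^esub> z)"
    and closed: "\<And>x y. x \<in> carrier S \<Longrightarrow> y \<in> carrier S \<Longrightarrow> x \<star>\<^bsub>S\<^esub> y \<in> carrier S"
    using S unfolding is_semigroup_def by blast+
  have eS: "e \<in> carrier S" and ee: "e \<star>\<^bsub>S\<^esub> e = e"
    using e by (auto simp: idempotents_def)
  have *: "x \<star>\<^bsub>S\<^esub> (e \<star>\<^bsub>S\<^esub> a) = x \<star>\<^bsub>S\<^esub> a" if x: "x \<in> left_mults S e" for x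
  proof -
    obtain y where y: "y \<in> carrier S" "x = y \<star>\<^bsub>S\<^esub> e"
      using x unfolding left_mults_def by blast
    have xS: "x \<in> carrier S" unfolding y(2) by (rule closed[OF y(1) eS])
    have "x \<star>\<^bsub>S\<^esub> (e \<star>\<^bsub>S\<^esub> a) = (x \<star>\<^bsub>S\<^esub> e) \<star>\<^bsub>S\<^esub> a"
      by (rule assoc[OF xS eS a, symmetric])
    also have "x \<star>\<^bsub>S\<^esub> e = x"
      by (simp only: y(2) assoc[OF y(1) eS eS] ee)
    finally show ?thesis .
  qed
  have "left_mults S e \<in> lobjs S" using e by (auto simp: lobjs_def)
  then show "component (principal_cone S a) (left_mults S e) = rho S e (e \<star>\<^bsub>S\<^esub> a) f"
    using * by (simp add: principal_cone_def rho_def left_mults_green_L[OF S a f L]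
        cong: restrict_cong)
  show "vertex (principal_cone S a) = left_mults S f"
    using left_mults_green_L[OF S a f L] by (simp add: principal_cone_def)
qed


section \<open>Rees matrix semigroups and coordinates of cones\<close>

definition rees ::
  "('g, 'm) monoid_scheme \<Rightarrow> 'i set \<Rightarrow> 'l set \<Rightarrow> ('l \<Rightarrow> 'i \<Rightarrow> 'g) \<Rightarrow> ('g \<times> 'i \<times> 'l) sgrp" where
  "rees G I \<Lambda> P =
     \<lparr>carrier = carrier G \<times> I \<times> \<Lambda>,
      smul = (\<lambda>(a, i, l) (b, j, m). (a \<otimes>\<^bsub>G\<^esub> P l j \<otimes>\<^bsub>G\<^esub> b, i, m))\<rparr>"

definition rees_obj :: "('g, 'm) monoid_scheme \<Rightarrow> 'i set \<Rightarrow> 'l \<Rightarrow> ('g \<times> 'i \<times> 'l) set" where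
  "rees_obj G I l = carrier G \<times> I \<times> {l}"

definition rees_mor ::
  "('g, 'm) monoid_scheme \<Rightarrow> 'i set \<Rightarrow> 'l \<Rightarrow> 'l \<Rightarrow> 'g \<Rightarrow> ('g \<times> 'i \<times> 'l) lmor" where
  "rees_mor G I l1 l2 g =
     \<lparr>ldom = rees_obj G I l1, lmap = (\<lambda>(h, i, l)\<in>rees_obj G I l1. (h \<otimes>\<^bsub>G\<^esub> g, i, l2)),
      lcod = rees_obj G I l2\<rparr>"

text \<open>Elements of the direct power are extensional functions on \<open>\<Lambda>\<close>; the first coordinate of the
  product is the pointwise product with the constant function with value \<open>d k\<close>.\<close>

definition sdprod :: "('g, 'm) monoid_scheme \<Rightarrow> 'l set \<Rightarrow> (('l \<Rightarrow> 'g) \<times> 'l) sgrp" where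
  "sdprod G \<Lambda> =
     \<lparr>carrier = (\<Lambda> \<rightarrow>\<^sub>E carrier G) \<times> \<Lambda>,
      smul = (\<lambda>(c, k) (d, l). (\<lambda>\<mu>\<in>\<Lambda>. c \<mu> \<otimes>\<^bsub>G\<^esub> d k, l))\<rparr>"

text \<open>The descriptions below are unique because \<open>I\<close> is nonempty: the sets \<open>rees_obj G I l\<close> are then
  pairwise distinct, and \<open>rees_mor G I l1 l2\<close> is injective on \<open>carrier G\<close>.\<close>

definition cone_index ::
  "('g, 'm) monoid_scheme \<Rightarrow> 'i set \<Rightarrow> 'l set \<Rightarrow> ('g \<times> 'i \<times> 'l) lcone \<Rightarrow> 'l" where
  "cone_index G I \<Lambda> \<gamma> = (THE l. l \<in> \<Lambda> \<and> vertex \<gamma> = rees_obj G I l)"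

definition cone_coords ::
  "('g, 'm) monoid_scheme \<Rightarrow> 'i set \<Rightarrow> 'l set \<Rightarrow> ('g \<times> 'i \<times> 'l) lcone \<Rightarrow> ('l \<Rightarrow> 'g) \<times> 'l" where
  "cone_coords G I \<Lambda> \<gamma> =
     (\<lambda>\<mu>\<in>\<Lambda>. THE g. g \<in> carrier G \<and>
        component \<gamma> (rees_obj G I \<mu>) = rees_mor G I \<mu> (cone_index G I \<Lambda> \<gamma>) g,
      cone_index G I \<Lambda> \<gamma>)"

end

(* A cone with vertex indexed by l is the same as a tuple (c, l), because every morphism between
   principal left ideals is right multiplication by a unique group element; composing morphisms
   multiplies these elements, which gives the semidirect product. The principal cone of (a, i, l)
   has coordinates (\<mu> \<mapsto> p_{\<mu> i} a, l), and a \<mapsto> \<rho>^a is a homomorphism, so the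
   principal cones inherit regularity from S. *)

theory Submission
  imports Defs
begin

section \<open>Semigroups: the semidirect product and homomorphic images\<close>

lemma PiE_const_mem: "f \<in> A \<rightarrow>\<^sub>E B \<Longrightarrow> x \<in> A \<Longrightarrow> f x \<in> B"
  by auto

text \<open>Both bracketings of (c, k), (d, l), (e, m) have the value c(\<mu>) d(k) e(l) at \<mu>;
  as k lies in \<Lambda>, the restricted inner product can be evaluated there.\<close>

lemma sdprod_semigroup:
  assumes "group G"
  shows "is_semigroup (sdprod G \<Lambda>)"
proof -
  interpret group G by fact
  show ?thesis
    by (auto simp: is_semigroup_def sdprod_def m_assoc PiE_const_mem intro!: restrict_ext)
qed

text \<open>If y is a witness for x in \<open>S\<close>, then h y is one for h x. It lies in the
  image, so the image is regular in itself.\<close>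

lemma regular_subsemigroup_hom_image:
  assumes "is_semigroup T" and "carrier S \<noteq> {}"
    and closed: "\<And>x y. x \<in> carrier S \<Longrightarrow> y \<in> carrier S \<Longrightarrow> x \<star>\<^bsub>S\<^esub> y \<in> carrier S"
    and regular: "\<And>x. x \<in> carrier S \<Longrightarrow> \<exists>y\<in>carrier S. x \<star>\<^bsub>S\<^esub> y \<star>\<^bsub>S\<^esub> x = x"
    and into: "\<And>x. x \<in> carrier S \<Longrightarrow> h x \<in> carrier T"
    and hom: "\<And>x y. x \<in> carrier S \<Longrightarrow> y \<in> carrier S \<Longrightarrow> h (x \<star>\<^bsub>S\<^esub> y) = h x \<star>\<^bsub>T\<^esub> h y"
  shows "regular_subsemigroup (h ` carrier S) T"
proof -
  have "\<exists>y\<in>carrier S. h x \<star>\<^bsub>T\<^esub> h y \<star>\<^bsub>T\<^esub> h x = h x" if "x \<in> carrier S" for x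
    using regular[OF that] closed hom that by metis
  moreover have "h x \<star>\<^bsub>T\<^esub> h y \<in> h ` carrier S" if "x \<in> carrier S" "y \<in> carrier S" for x y
    using closed hom that by (metis imageI)
  ultimately show ?thesis
    using assms(1,2) into by (auto simp: regular_subsemigroup_def subsemigroup_def)
qed

lemma rees_mult [simp]:
  "(a, i, l) \<star>\<^bsub>rees G I \<Lambda> P\<^esub> (b, j, m) = (a \<otimes>\<^bsub>G\<^esub> P l j \<otimes>\<^bsub>G\<^esub> b, i, m)"
  by (simp add: rees_def)

lemma rees_carrier [simp]: "carrier (rees G I \<Lambda> P) = carrier G \<times> I \<times> \<Lambda>"
  by (simp add: rees_def)

lemma sdprod_mult [simp]:
  "(c, k) \<star>\<^bsub>sdprod G \<Lambda>\<^esub> (d, l) = (\<lambda>\<mu>\<in>\<Lambda>. c \<mu> \<otimes>\<^bsub>G\<^esub> d k, l)"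
  by (simp add: sdprod_def)

lemma sdprod_carrier [simp]: "carrier (sdprod G \<Lambda>) = (\<Lambda> \<rightarrow>\<^sub>E carrier G) \<times> \<Lambda>"
  by (simp add: sdprod_def)

section \<open>The category of principal left ideals of a Rees matrix semigroup\<close>

locale rees_matrix = group G
  for G :: "('g, 'm) monoid_scheme" (structure) +
  fixes I :: "'i set" and \<Lambda> :: "'l set" and P :: "'l \<Rightarrow> 'i \<Rightarrow> 'g"
  assumes I_nonempty: "I \<noteq> {}" and \<Lambda>_nonempty: "\<Lambda> \<noteq> {}"
    and P_closed [simp]: "\<And>l i. l \<in> \<Lambda> \<Longrightarrow> i \<in> I \<Longrightarrow> P l i \<in> carrier G"
begin

abbreviation S where "S \<equiv> rees G I \<Lambda> P"
abbreviation obj where "obj \<equiv> rees_obj G I"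
abbreviation mor where "mor \<equiv> rees_mor G I"

lemma obj_eq_iff [simp]: "obj l = obj m \<longleftrightarrow> l = m"
  using I_nonempty one_closed by (auto simp: rees_obj_def times_eq_iff)

text \<open>The objects are nonempty and pairwise disjoint, so the only inclusions in the category
  are identities.\<close>

lemma obj_subset_iff [simp]: "obj l \<subseteq> obj m \<longleftrightarrow> l = m"
  using I_nonempty one_closed by (auto simp: rees_obj_def times_subset_iff)

lemma left_mults_rees:
  assumes "a \<in> carrier G" "i \<in> I" "l \<in> \<Lambda>"
  shows "left_mults S (a, i, l) = obj l"
proof
  show "left_mults S (a, i, l) \<subseteq> obj l"
    using assms by (auto simp: left_mults_def rees_obj_def)
  show "obj l \<subseteq> left_mults S (a, i, l)"
  proof
    fix x assume "x \<in> obj l"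
    then obtain h j where x: "x = (h, j, l)" "h \<in> carrier G" "j \<in> I"
      by (auto simp: rees_obj_def)
    \<comment> \<open>Division in the group: the first coordinate of y solves y p_{li} a =
      h.\<close>
    define y where "y = (h \<otimes> inv (P l i \<otimes> a), j, l)"
    have "x = y \<star>\<^bsub>S\<^esub> (a, i, l)" "y \<in> carrier S"
      using x assms by (simp_all add: y_def m_assoc)
    then show "x \<in> left_mults S (a, i, l)"
      unfolding left_mults_def by blast
  qed
qed

lemma idempotent_rees: "i \<in> I \<Longrightarrow> l \<in> \<Lambda> \<Longrightarrow> (inv (P l i), i, l) \<in> idempotents S"
  by (simp add: idempotents_def)

lemma lobjs_rees: "lobjs S = obj ` \<Lambda>"
proof
  show "lobjs S \<subseteq> obj ` \<Lambda>"
    by (auto simp: lobjs_def idempotents_def left_mults_rees)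
  show "obj ` \<Lambda> \<subseteq> lobjs S"
  proof clarify
    fix l assume l: "l \<in> \<Lambda>"
    obtain i where i: "i \<in> I" using I_nonempty by blast
    have "obj l = left_mults S (inv (P l i), i, l)"
      using i l by (simp add: left_mults_rees)
    then show "obj l \<in> lobjs S"
      unfolding lobjs_def using idempotent_rees[OF i l] by (rule image_eqI)
  qed
qed

lemma obj_in_lobjs [simp]: "l \<in> \<Lambda> \<Longrightarrow> obj l \<in> lobjs S"
  by (simp add: lobjs_rees)

text \<open>The product (h, k, l)(s, i, m) has first coordinate h p_{li} s, so the sandwich entry is
  absorbed into the translating element. The middle index of s is that of e because s comes from
  eSf.\<close>

lemma rho_rees:
  assumes "a \<in> carrier G" "i \<in> I" "l \<in> \<Lambda>" "b \<in> carrier G" "j \<in> I" "m \<in> \<Lambda>" "s \<in> carrier G"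
  shows "rho S (a, i, l) (s, i, m) (b, j, m) = mor l m (P l i \<otimes> s)"
  using assms
  by (auto simp: rho_def rees_mor_def left_mults_rees rees_obj_def m_assoc intro!: restrict_ext)

lemma lhom_rees:
  assumes l: "l \<in> \<Lambda>" and m: "m \<in> \<Lambda>"
  shows "lhom S (obj l) (obj m) = mor l m ` carrier G"
proof
  show "lhom S (obj l) (obj m) \<subseteq> mor l m ` carrier G"
  proof
    fix f assume "f \<in> lhom S (obj l) (obj m)"
    then obtain e x g where *: "f = rho S e (e \<star>\<^bsub>S\<^esub> x \<star>\<^bsub>S\<^esub> g) g"
      "e \<in> carrier S" "g \<in> carrier S" "x \<in> carrier S"
      "left_mults S e = obj l" "left_mults S g = obj m"
      by (auto simp: lhom_def idempotents_def)
    \<comment> \<open>The ideals generated by e and g fix their last coordinates as l and m.\<close>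
    then obtain a i b j c k n where "e = (a, i, l)" "g = (b, j, m)" "x = (c, k, n)"
      by (cases e; cases g; cases x) (auto simp: left_mults_rees)
    then show "f \<in> mor l m ` carrier G"
      using * l m by (auto simp: rho_rees)
  qed
  show "mor l m ` carrier G \<subseteq> lhom S (obj l) (obj m)"
  proof clarify
    fix g assume g: "g \<in> carrier G"
    obtain i where i: "i \<in> I" using I_nonempty by blast
    \<comment> \<open>The factor inv p_{li} in x cancels the sandwich entry in
      \<open>rho_rees\<close>, which leaves g. Since e x f = x, the element x lies in eSf.\<close>
    define e f x where "e = (inv (P l i), i, l)" and "f = (inv (P m i), i, m)"
      and "x = (inv (P l i) \<otimes> g, i, m)"
    have efS: "e \<in> idempotents S" "f \<in> idempotents S"
      using idempotent_rees i l m by (auto simp: e_def f_def)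
    have efx: "e \<star>\<^bsub>S\<^esub> x \<star>\<^bsub>S\<^esub> f = x" and xS: "x \<in> carrier S"
      using g i l m by (simp_all add: e_def f_def x_def m_assoc)
    have "mor l m g = rho S e x f"
      using g i l m by (simp add: e_def f_def x_def rho_rees flip: m_assoc)
    moreover have "left_mults S e = obj l" "left_mults S f = obj m"
      using i l m by (simp_all add: e_def f_def left_mults_rees)
    moreover have "x \<in> (\<lambda>x. e \<star>\<^bsub>S\<^esub> x \<star>\<^bsub>S\<^esub> f) ` carrier S"
      using efx xS by (metis imageI)
    ultimately show "mor l m g \<in> lhom S (obj l) (obj m)"
      unfolding lhom_def using efS by blast
  qed
qed

lemma mor_comp:
  assumes "g \<in> carrier G" "h \<in> carrier G"
  shows "mor l m g ;; mor m n h = mor l n (g \<otimes> h)"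
  using assms by (auto simp: lcomp_def rees_mor_def compose_def rees_obj_def m_assoc fun_eq_iff)

lemma lincl_obj: "lincl (obj l) (obj l) = mor l l \<one>"
  by (auto simp: lincl_def rees_mor_def rees_obj_def fun_eq_iff)

lemma mor_eq_iff [simp]:
  assumes "g \<in> carrier G" "h \<in> carrier G"
  shows "mor l m g = mor l m h \<longleftrightarrow> g = h"
proof
  assume eq: "mor l m g = mor l m h"
  obtain i where "i \<in> I" using I_nonempty by blast
  \<comment> \<open>The value at (\<one>, i, l) has first coordinate g, respectively h.\<close>
  then show "g = h"
    using arg_cong[OF eq, of "\<lambda>f. lmap f (\<one>, i, l)"] assms
    by (simp add: rees_mor_def rees_obj_def)
qed simp

text \<open>The morphism given by inv g is a two-sided inverse, so every morphism is an
  isomorphism.\<close>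

lemma liso_rees:
  assumes "l \<in> \<Lambda>" "m \<in> \<Lambda>"
  shows "liso S (obj l) (obj m) = mor l m ` carrier G"
proof -
  have "\<exists>h\<in>carrier G. mor l m g ;; mor m l h = mor l l \<one> \<and> mor m l h ;; mor l m g = mor m m \<one>"
    if "g \<in> carrier G" for g
    using that by (intro bexI[of _ "inv g"]) (simp_all add: mor_comp)
  then show ?thesis
    using assms by (auto simp: liso_def lhom_rees lincl_obj)
qed

section \<open>Normal cones as elements of the semidirect product\<close>

text \<open>Intended inverse of \<open>cone_coords\<close>. Components are indexed by objects rather
  than by \<Lambda>, so \<open>inv_into\<close> recovers the index; this is sound because
  \<open>obj\<close> is injective.\<close>

definition cone_of :: "('l \<Rightarrow> 'g) \<times> 'l \<Rightarrow> ('g \<times> 'i \<times> 'l) lcone" where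
  "cone_of = (\<lambda>(c, l). \<lparr>vertex = obj l,
     component = (\<lambda>A\<in>lobjs S. let \<mu> = inv_into \<Lambda> obj A in mor \<mu> l (c \<mu>))\<rparr>)"

lemma vertex_cone_of [simp]: "vertex (cone_of (c, l)) = obj l"
  by (simp add: cone_of_def)

lemma component_cone_of [simp]:
  "\<mu> \<in> \<Lambda> \<Longrightarrow> component (cone_of (c, l)) (obj \<mu>) = mor \<mu> l (c \<mu>)"
  by (simp add: cone_of_def inv_into_f_f inj_on_def)

lemma component_cone_of_extensional: "component (cone_of p) \<in> extensional (lobjs S)"
  by (auto simp: cone_of_def split: prod.split)

text \<open>The sets \<open>obj\<close> \<mu> exhaust the objects, and off the objects both
  component functions are \<open>undefined\<close>. Every later identification of a cone goes
  through this rule.\<close>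

lemma cone_of_eqI:
  assumes "vertex \<gamma> = obj l" "component \<gamma> \<in> extensional (lobjs S)"
    and "\<And>\<mu>. \<mu> \<in> \<Lambda> \<Longrightarrow> component \<gamma> (obj \<mu>) = mor \<mu> l (c \<mu>)"
  shows "\<gamma> = cone_of (c, l)"
proof (rule lcone.equality)
  show "component \<gamma> = component (cone_of (c, l))"
    by (rule extensionalityI[OF assms(2) component_cone_of_extensional])
      (use assms(3) in \<open>auto simp: lobjs_rees\<close>)
qed (use assms(1) in simp_all)

lemma cone_index_cone_of:
  assumes "l \<in> \<Lambda>"
  shows "cone_index G I \<Lambda> (cone_of (c, l)) = l"
  using assms by (auto simp: cone_index_def)

lemma cone_coords_cone_of:
  assumes "p \<in> carrier (sdprod G \<Lambda>)"
  shows "cone_coords G I \<Lambda> (cone_of p) = p"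
proof -
  obtain c l where p: "p = (c, l)" "c \<in> \<Lambda> \<rightarrow>\<^sub>E carrier G" "l \<in> \<Lambda>"
    using assms by auto
  have "(THE g. g \<in> carrier G \<and> component (cone_of (c, l)) (obj \<mu>) = mor \<mu> l g) = c \<mu>"
    if "\<mu> \<in> \<Lambda>" for \<mu>
    using that PiE_mem[OF p(2) that] by (intro the_equality) auto
  \<comment> \<open>The two sides also agree off \<Lambda>, since c is extensional.\<close>
  then have "(\<lambda>\<mu>\<in>\<Lambda>. THE g. g \<in> carrier G \<and>
      component (cone_of (c, l)) (obj \<mu>) = mor \<mu> l g) = c"
    using p(2) by (intro extensionalityI[of _ \<Lambda>]) (auto simp: PiE_def)
  then show ?thesis
    using p(3) by (simp add: p(1) cone_coords_def cone_index_cone_of)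
qed

lemma normal_cone_cone_of:
  assumes "p \<in> carrier (sdprod G \<Lambda>)"
  shows "normal_cone S (cone_of p)"
proof -
  obtain c l where p: "p = (c, l)" "c \<in> \<Lambda> \<rightarrow>\<^sub>E carrier G" "l \<in> \<Lambda>"
    using assms by auto
  have c: "c \<mu> \<in> carrier G" if "\<mu> \<in> \<Lambda>" for \<mu> using p(2) that by auto
  show ?thesis
    unfolding normal_cone_def
  proof (intro conjI ballI impI)
    show "component (cone_of p) A \<in> lhom S A (vertex (cone_of p))" if "A \<in> lobjs S" for A
      using that p c by (auto simp: lobjs_rees lhom_rees)
    \<comment> \<open>Here A = B, and the inclusion is translation by \<one>.\<close>
    show "lincl A B ;; component (cone_of p) B = component (cone_of p) A"
      if "A \<in> lobjs S" "B \<in> lobjs S" "A \<subseteq> B" for A B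
      using that p(1) c by (auto simp: lobjs_rees lincl_obj mor_comp)
    have "component (cone_of p) (obj l) \<in> liso S (obj l) (vertex (cone_of p))"
      using p c by (simp add: liso_rees)
    then show "\<exists>A\<in>lobjs S. component (cone_of p) A \<in> liso S A (vertex (cone_of p))"
      using p(3) by (blast intro: obj_in_lobjs)
  qed (use p component_cone_of_extensional in simp_all)
qed

lemma normal_cone_imp_cone_of:
  assumes "normal_cone S \<gamma>"
  shows "\<exists>p\<in>carrier (sdprod G \<Lambda>). \<gamma> = cone_of p"
proof -
  obtain l where l: "l \<in> \<Lambda>" "vertex \<gamma> = obj l"
    using assms by (auto simp: normal_cone_def lobjs_rees)
  have "\<forall>\<mu>\<in>\<Lambda>. \<exists>g\<in>carrier G. component \<gamma> (obj \<mu>) = mor \<mu> l g"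
    using assms l by (auto simp: normal_cone_def lobjs_rees lhom_rees)
  then obtain c where c: "\<And>\<mu>. \<mu> \<in> \<Lambda> \<Longrightarrow> c \<mu> \<in> carrier G"
    "\<And>\<mu>. \<mu> \<in> \<Lambda> \<Longrightarrow> component \<gamma> (obj \<mu>) = mor \<mu> l (c \<mu>)"
    by metis
  \<comment> \<open>The chosen c is arbitrary off \<Lambda>; restricting it gives an element of the
    direct power.\<close>
  have "\<gamma> = cone_of (restrict c \<Lambda>, l)"
    by (rule cone_of_eqI) (use assms l c in \<open>auto simp: normal_cone_def\<close>)
  moreover have "(restrict c \<Lambda>, l) \<in> carrier (sdprod G \<Lambda>)"
    using c l by auto
  ultimately show ?thesis by blast
qed

lemma TL_rees_carrier: "carrier (TL S) = cone_of ` carrier (sdprod G \<Lambda>)"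
  using normal_cone_cone_of normal_cone_imp_cone_of
  by (fastforce simp: TL_def simp del: sdprod_carrier)

lemma cone_of_mult:
  assumes "p \<in> carrier (sdprod G \<Lambda>)" "q \<in> carrier (sdprod G \<Lambda>)"
  shows "cone_of p \<star>\<^bsub>TL S\<^esub> cone_of q = cone_of (p \<star>\<^bsub>sdprod G \<Lambda>\<^esub> q)"
proof -
  obtain c k d l where pq: "p = (c, k)" "q = (d, l)" "c \<in> \<Lambda> \<rightarrow>\<^sub>E carrier G" "k \<in> \<Lambda>"
    "d \<in> \<Lambda> \<rightarrow>\<^sub>E carrier G" "l \<in> \<Lambda>"
    using assms by auto
  \<comment> \<open>At \<open>obj\<close> \<mu> the morphism of c(\<mu>) into \<open>obj\<close> k
    is followed by the second cone's component at \<open>obj\<close> k, which is d(k).\<close>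
  have "cone_mult S (cone_of p) (cone_of q) = cone_of (\<lambda>\<mu>\<in>\<Lambda>. c \<mu> \<otimes> d k, l)"
    by (rule cone_of_eqI)
      (use pq in \<open>auto simp: cone_mult_def mor_comp PiE_const_mem\<close>)
  then show ?thesis
    by (simp add: TL_def pq(1,2))
qed

lemma sdprod_mult_closed:
  assumes "p \<in> carrier (sdprod G \<Lambda>)" "q \<in> carrier (sdprod G \<Lambda>)"
  shows "p \<star>\<^bsub>sdprod G \<Lambda>\<^esub> q \<in> carrier (sdprod G \<Lambda>)"
  using sdprod_semigroup[OF is_group] assms unfolding is_semigroup_def by blast

text \<open>\<open>cone_of\<close> maps onto the normal cones and has \<open>cone_coords\<close> as
  left inverse, so the two are mutually inverse; multiplicativity is that of \<open>cone_of\<close>,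
  read backwards.\<close>

lemma cone_coords_iso: "cone_coords G I \<Lambda> \<in> sgrp_iso (TL S) (sdprod G \<Lambda>)"
proof -
  have "bij_betw (cone_coords G I \<Lambda>) (carrier (TL S)) (carrier (sdprod G \<Lambda>))"
    unfolding TL_rees_carrier
    by (rule bij_betw_byWitness[where f' = cone_of])
      (auto simp: cone_coords_cone_of simp del: sdprod_carrier)
  moreover have "cone_coords G I \<Lambda> (x \<star>\<^bsub>TL S\<^esub> y) =
      cone_coords G I \<Lambda> x \<star>\<^bsub>sdprod G \<Lambda>\<^esub> cone_coords G I \<Lambda> y"
    if "x \<in> carrier (TL S)" "y \<in> carrier (TL S)" for x y
    using that unfolding TL_rees_carrier
    by (auto simp: cone_of_mult cone_coords_cone_of sdprod_mult_closed
        simp del: sdprod_carrier sdprod_mult)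
  ultimately show ?thesis by (simp add: sgrp_iso_def)
qed

section \<open>Principal cones and their regularity\<close>

text \<open>Right multiplication by (a, i, l) sends (h, j, \<mu>) to (h p_{\<mu>i} a, j, l).\<close>

lemma principal_cone_rees:
  assumes "a \<in> carrier G" "i \<in> I" "l \<in> \<Lambda>"
  shows "principal_cone S (a, i, l) = cone_of (\<lambda>\<mu>\<in>\<Lambda>. P \<mu> i \<otimes> a, l)"
proof (rule cone_of_eqI)
  show "component (principal_cone S (a, i, l)) (obj \<mu>) = mor \<mu> l ((\<lambda>\<mu>\<in>\<Lambda>. P \<mu> i \<otimes> a) \<mu>)"
    if "\<mu> \<in> \<Lambda>" for \<mu>
    using that assms obj_in_lobjs[OF that]
    by (auto simp: principal_cone_def rees_mor_def left_mults_rees rees_obj_def m_assoc fun_eq_iff)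
qed (use assms in \<open>auto simp: principal_cone_def left_mults_rees\<close>)

lemma principal_coords_in_sdprod:
  assumes "a \<in> carrier G" "i \<in> I" "l \<in> \<Lambda>"
  shows "(\<lambda>\<mu>\<in>\<Lambda>. P \<mu> i \<otimes> a, l) \<in> carrier (sdprod G \<Lambda>)"
  using assms by auto

lemma cone_coords_principal_cone:
  assumes "a \<in> carrier G" "i \<in> I" "l \<in> \<Lambda>"
  shows "cone_coords G I \<Lambda> (principal_cone S (a, i, l)) = (\<lambda>\<mu>\<in>\<Lambda>. P \<mu> i \<otimes> a, l)"
  using assms by (simp only: principal_cone_rees cone_coords_cone_of principal_coords_in_sdprod)

lemma principal_cones_subset: "principal_cone S ` carrier S \<subseteq> carrier (TL S)"
  unfolding TL_rees_carrier
  by (auto simp: principal_cone_rees simp del: sdprod_carrier intro: principal_coords_in_sdprod)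

lemma rees_regular:
  assumes "x \<in> carrier S"
  shows "\<exists>y\<in>carrier S. x \<star>\<^bsub>S\<^esub> y \<star>\<^bsub>S\<^esub> x = x"
proof -
  obtain a i l where x: "x = (a, i, l)" "a \<in> carrier G" "i \<in> I" "l \<in> \<Lambda>"
    using assms by auto
  \<comment> \<open>With the indices of x reused, both sandwich entries in x y x equal p = p_{li};
    the equation a p b p a = a then forces this b.\<close>
  define y where "y = (inv (P l i) \<otimes> inv a \<otimes> inv (P l i), i, l)"
  have "y \<in> carrier S" using x by (simp add: y_def)
  moreover have "x \<star>\<^bsub>S\<^esub> y \<star>\<^bsub>S\<^esub> x = x"
    using x by (simp add: y_def m_assoc inv_solve_left')
  ultimately show ?thesis by blast
qed

lemma principal_cones_regular:
  "regular_subsemigroup (cone_coords G I \<Lambda> ` principal_cone S ` carrier S) (sdprod G \<Lambda>)"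
  \<comment> \<open>Merges the two images into the image of \<open>S\<close> under one map, to be
    shown a homomorphism.\<close>
  unfolding image_image
proof (rule regular_subsemigroup_hom_image)
  show "is_semigroup (sdprod G \<Lambda>)"
    by (rule sdprod_semigroup[OF is_group])
  show "carrier S \<noteq> {}"
    using I_nonempty \<Lambda>_nonempty one_closed by auto
  show "x \<star>\<^bsub>S\<^esub> y \<in> carrier S" if "x \<in> carrier S" "y \<in> carrier S" for x y
    using that by auto
  show "\<exists>y\<in>carrier S. x \<star>\<^bsub>S\<^esub> y \<star>\<^bsub>S\<^esub> x = x" if "x \<in> carrier S" for x
    using that by (rule rees_regular)
  show "cone_coords G I \<Lambda> (principal_cone S x) \<in> carrier (sdprod G \<Lambda>)"
    if "x \<in> carrier S" for x
    using that by (auto simp: cone_coords_principal_cone)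
  \<comment> \<open>For x = (a, i, k) and y = (b, j, l), the \<mu>-coordinate of the cone of xy is
    (p_{\<mu>i} a)(p_{kj} b), whose second factor is the k-coordinate of the cone of y.\<close>
  show "cone_coords G I \<Lambda> (principal_cone S (x \<star>\<^bsub>S\<^esub> y)) =
      cone_coords G I \<Lambda> (principal_cone S x) \<star>\<^bsub>sdprod G \<Lambda>\<^esub> cone_coords G I \<Lambda> (principal_cone S y)"
    if "x \<in> carrier S" "y \<in> carrier S" for x y
    using that by (auto simp: cone_coords_principal_cone m_assoc intro!: restrict_ext)
qed

end

theorem proposition17:
  fixes G :: "('g, 'm) monoid_scheme" and I :: "'i set" and \<Lambda> :: "'l set"
    and P :: "'l \<Rightarrow> 'i \<Rightarrow> 'g"
  assumes "group G" and "I \<noteq> {}" and "\<Lambda> \<noteq> {}"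
    and "\<And>l i. l \<in> \<Lambda> \<Longrightarrow> i \<in> I \<Longrightarrow> P l i \<in> carrier G"
  shows "cone_coords G I \<Lambda> \<in> sgrp_iso (TL (rees G I \<Lambda> P)) (sdprod G \<Lambda>) \<and>
    principal_cone (rees G I \<Lambda> P) ` carrier (rees G I \<Lambda> P) \<subseteq> carrier (TL (rees G I \<Lambda> P)) \<and>
    regular_subsemigroup
      (cone_coords G I \<Lambda> ` principal_cone (rees G I \<Lambda> P) ` carrier (rees G I \<Lambda> P)) (sdprod G \<Lambda>)"
proof -
  interpret rees_matrix G I \<Lambda> P
    by (intro rees_matrix.intro rees_matrix_axioms.intro assms)
  show ?thesis
    using cone_coords_iso principal_cones_subset principal_cones_regular by blast
qed

end
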